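(* Let $\Omega:=\{(x,y)\in\mathbb{R}^m\times\mathbb{R}^m \mid x\in\mathcal{K},\ y\in\mathcal{K},\ x^Ty=0\}$, where $\mathcal{K}$ is the $m$-dimensional second-order cone, and let $(x,y)\in\Omega$. Then the regular normal cone and the proximal normal cone of $\Omega$ at $(x,y)$ coincide: $$\widehat{N}_\Omega(x,y)=N^\pi_\Omega(x,y).$$
   Context: Vectors of $\mathbb{R}^m$ are written $x=(x_1,x_2)\in\mathbb{R}\times\mathbb{R}^{m-1}$; $\|\cdot\|$ is the Euclidean norm. The second-order cone is $\mathcal{K}:=\{(x_1,x_2)\in\mathbb{R}\times\mathbb{R}^{m-1}\mid x_1\ge\|x_2\|\}$. For $C\subset\mathbb{R}^n$ and $x^*\in\operatorname{cl}C$: - the proximal normal cone is $N^\pi_C(x^* ):=\{v\in\mathbb{R}^n\mid \exists M>0 \text{ such that } \langle v,x-x^*\rangle\le M\|x-x^*\|^2\ \ \forall x\in C\}$; - the regular (Fréchet) normal cone is $\widehat{N}_C(x^* ):=\{v\in\mathbb{R}^n\mid \langle v,x-x^*\rangle\le o(\|x-x^*\|)\ \ \forall x\in C\}$, i.e. $v\in\widehat{N}_C(x^* )$ iff $\limsup_{x\to x^*,\,x\in C,\,x\ne x^*}\langle v,x-x^*\rangle/\|x-x^*\|\le 0$. *)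

theory Defs
  imports "HOL-Analysis.Analysis"
begin

text \<open>
  \<open>\<real>\<^sup>m\<close> is \<^typ>\<open>real ^ 'm\<close> with \<open>m = CARD('m)\<close>. The splitting \<open>x = (x\<^sub>1, x\<^sub>2)\<close> singles out a
  coordinate \<open>k\<close>: \<open>x\<^sub>1\<close> is \<open>x $ k\<close>, and \<open>x\<^sub>2\<close> consists of the remaining \<open>m - 1\<close> coordinates.
  This rendering includes \<open>m = 1\<close>, which \<open>real \<times> 'a\<close> with \<open>'a :: euclidean_space\<close> would not.
\<close>

definition second_order_cone :: "'m::finite \<Rightarrow> (real ^ 'm) set" where
  "second_order_cone k = {x. x $ k \<ge> L2_set (\<lambda>j. x $ j) (UNIV - {k})}"

definition soc_complementarity_set :: "'m::finite \<Rightarrow> ((real ^ 'm) \<times> (real ^ 'm)) set" where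
  "soc_complementarity_set k =
     {(x, y). x \<in> second_order_cone k \<and> y \<in> second_order_cone k \<and> x \<bullet> y = 0}"

text \<open>Both normal cones are meant for base points in \<open>closure C\<close> only.\<close>

definition proximal_normal_cone :: "'a::euclidean_space set \<Rightarrow> 'a \<Rightarrow> 'a set" where
  "proximal_normal_cone C p = {v. \<exists>M>0. \<forall>x\<in>C. v \<bullet> (x - p) \<le> M * (norm (x - p))\<^sup>2}"

text \<open>
  The filter \<open>at p within C\<close> excludes \<open>x = p\<close>. If \<open>p\<close> is isolated in \<open>C\<close>, the upper limit
  is \<open>-\<infinity>\<close> and every vector is a regular normal.
\<close>

definition regular_normal_cone :: "'a::euclidean_space set \<Rightarrow> 'a \<Rightarrow> 'a set" where
  "regular_normal_cone C p =
     {v. Limsup (at p within C) (\<lambda>x. ereal (v \<bullet> (x - p) / norm (x - p))) \<le> 0}"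

end

theory Submission
  imports Defs
begin

text \<open>
  A regular normal \<open>v\<close> at \<open>p\<close> has nonpositive inner product with every tangent direction of the
  set. The two normal cones therefore agree as soon as each point \<open>q\<close> of the set near \<open>p\<close> admits a
  tangent direction \<open>w\<close> at \<open>p\<close> with \<open>\<parallel>(q - p) - w\<parallel> = O(\<parallel>q - p\<parallel>\<^sup>2)\<close>, uniformly in \<open>q\<close>: then
  \<open>v \<bullet> (q - p) \<le> v \<bullet> ((q - p) - w) = O(\<parallel>q - p\<parallel>\<^sup>2)\<close>, while points far from \<open>p\<close> satisfy a quadratic
  bound by Cauchy--Schwarz. This criterion is
  \<open>regular_eq_proximal_if_quadratically_approximable\<close>.

  It remains to find such directions for the complementarity set of the second-order cone. Write
  \<open>e\<close> for the axis of the cone. Two complementary elements that are both nonzero lie on boundary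
  rays with opposite off-axis directions, so the pair equals \<open>(\<parallel>u\<parallel> e + u, s (\<parallel>u\<parallel> e - u))\<close> with \<open>u \<bullet> e = 0\<close>, \<open>u \<noteq> 0\<close> and
  \<open>s > 0\<close> (\<open>complementary_nonzeroE\<close>). This parametrization is smooth for \<open>u \<noteq> 0\<close>, has
  a quadratic Taylor remainder (\<open>boundary_pair_expansion\<close>), and its parameters depend in a
  Lipschitz way on the pair; so its derivative in the direction of the parameter increment is the
  required \<open>w\<close>. The parametrization also covers \<open>s = 0\<close>, that is, the base points \<open>(x, 0)\<close> with \<open>x\<close>
  a nonzero boundary element. Near such a point there are also pairs \<open>(x', 0)\<close>; they
  are joined to it by a segment in the set, so \<open>w = q - p\<close> works. The same
  choice settles \<open>(0, 0)\<close>, as the set is a cone, and the points \<open>(x, 0)\<close> with \<open>x\<close> interior. Exchanging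
  the two components gives the remaining base points.
\<close>

section \<open>Regular and proximal normals\<close>

lemma regular_normal_cone_iff:
  fixes C :: "'a::euclidean_space set"
  shows "v \<in> regular_normal_cone C p \<longleftrightarrow>
    (\<forall>\<epsilon>>0. \<exists>\<delta>>0. \<forall>x\<in>C. norm (x - p) < \<delta> \<longrightarrow> v \<bullet> (x - p) \<le> \<epsilon> * norm (x - p))"
proof
  assume v: "v \<in> regular_normal_cone C p"
  show "\<forall>\<epsilon>>0. \<exists>\<delta>>0. \<forall>x\<in>C. norm (x - p) < \<delta> \<longrightarrow> v \<bullet> (x - p) \<le> \<epsilon> * norm (x - p)"
  proof (intro allI impI)
    fix \<epsilon> :: real assume "\<epsilon> > 0"
    then have "\<forall>\<^sub>F x in at p within C. ereal (v \<bullet> (x - p) / norm (x - p)) < ereal \<epsilon>"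
      using v unfolding regular_normal_cone_def mem_Collect_eq Limsup_le_iff
      by (metis ereal_less(2))
    then obtain \<delta> where \<delta>: "\<delta> > 0"
      "\<And>x. x \<in> C \<Longrightarrow> x \<noteq> p \<Longrightarrow> dist x p < \<delta> \<Longrightarrow> v \<bullet> (x - p) / norm (x - p) < \<epsilon>"
      unfolding eventually_at by auto
    have "v \<bullet> (x - p) \<le> \<epsilon> * norm (x - p)" if "x \<in> C" "norm (x - p) < \<delta>" for x
    proof (cases "x = p")
      case False
      then show ?thesis
        using \<delta>(2)[of x] that by (auto simp: dist_norm divide_less_eq)
    qed auto
    then show "\<exists>\<delta>>0. \<forall>x\<in>C. norm (x - p) < \<delta> \<longrightarrow> v \<bullet> (x - p) \<le> \<epsilon> * norm (x - p)"
      using \<delta>(1) by blast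
  qed
next
  assume *: "\<forall>\<epsilon>>0. \<exists>\<delta>>0. \<forall>x\<in>C. norm (x - p) < \<delta> \<longrightarrow> v \<bullet> (x - p) \<le> \<epsilon> * norm (x - p)"
  have "\<forall>\<^sub>F x in at p within C. ereal (v \<bullet> (x - p) / norm (x - p)) < y" if "y > 0" for y
  proof -
    obtain \<epsilon> where \<epsilon>: "0 < \<epsilon>" "ereal \<epsilon> < y"
      using ereal_dense2[of 0 y] \<open>y > 0\<close> by auto
    then obtain \<delta> where \<delta>: "\<delta> > 0"
      "\<And>x. x \<in> C \<Longrightarrow> norm (x - p) < \<delta> \<Longrightarrow> v \<bullet> (x - p) \<le> \<epsilon> * norm (x - p)"
      using * by blast
    have "ereal (v \<bullet> (x - p) / norm (x - p)) < y" if "x \<in> C" "x \<noteq> p" "dist x p < \<delta>" for x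
    proof -
      have "v \<bullet> (x - p) / norm (x - p) \<le> \<epsilon>"
        using \<delta>(2)[of x] that by (simp add: dist_norm divide_le_eq)
      then show ?thesis
        using \<epsilon>(2) by (metis ereal_less_eq(3) order.strict_trans1)
    qed
    then show ?thesis
      unfolding eventually_at using \<delta>(1) by blast
  qed
  then show "v \<in> regular_normal_cone C p"
    unfolding regular_normal_cone_def mem_Collect_eq Limsup_le_iff by blast
qed

text \<open>
  A quadratic bound is \<open>o(\<parallel>x - p\<parallel>)\<close>.
\<close>

lemma proximal_subset_regular:
  fixes C :: "'a::euclidean_space set"
  shows "proximal_normal_cone C p \<subseteq> regular_normal_cone C p"
proof
  fix v assume "v \<in> proximal_normal_cone C p"
  then obtain M where M: "M > 0" "\<And>x. x \<in> C \<Longrightarrow> v \<bullet> (x - p) \<le> M * (norm (x - p))\<^sup>2"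
    unfolding proximal_normal_cone_def by blast
  have "v \<bullet> (x - p) \<le> \<epsilon> * norm (x - p)"
    if "\<epsilon> > 0" "x \<in> C" "norm (x - p) < \<epsilon> / M" for \<epsilon> x
  proof -
    have "M * norm (x - p) \<le> \<epsilon>"
      using that M(1) by (simp add: field_simps)
    then have "M * norm (x - p) * norm (x - p) \<le> \<epsilon> * norm (x - p)"
      by (rule mult_right_mono) simp
    then show ?thesis
      using M(2)[OF that(2)] by (simp add: power2_eq_square mult.assoc)
  qed
  then show "v \<in> regular_normal_cone C p"
    unfolding regular_normal_cone_iff using M(1) by (meson divide_pos_pos)
qed

text \<open>
  A restricted form of Bouligand tangency: the distance from \<open>p + t w\<close> to the set is \<open>O(t\<^sup>2)\<close>
  instead of merely \<open>o(t)\<close>.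
\<close>

definition quadratic_tangent :: "'a::real_normed_vector set \<Rightarrow> 'a \<Rightarrow> 'a \<Rightarrow> bool" where
  "quadratic_tangent C p w \<longleftrightarrow>
     (\<exists>K. \<forall>t. 0 < t \<and> t \<le> 1 \<longrightarrow> (\<exists>c\<in>C. norm (c - p - t *\<^sub>R w) \<le> K * t\<^sup>2))"

text \<open>
  The constant \<open>M\<close> is the same for all \<open>q\<close>, as it ends up in the proximal bound; the constant in
  the tangency of \<open>w\<close> may depend on \<open>q\<close>, as it disappears in a limit.
\<close>

definition quadratically_approximable :: "'a::real_normed_vector set \<Rightarrow> 'a \<Rightarrow> bool" where
  "quadratically_approximable C p \<longleftrightarrow>
     (\<exists>\<delta>>0. \<exists>M. \<forall>q\<in>C. norm (q - p) < \<delta> \<longrightarrow>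
        (\<exists>w. quadratic_tangent C p w \<and> norm (q - p - w) \<le> M * (norm (q - p))\<^sup>2))"

text \<open>
  Testing the normal \<open>v\<close> on points of the set near \<open>p + t w\<close>, dividing by \<open>t\<close> and letting \<open>t\<close> tend
  to \<open>0\<close> gives \<open>v \<bullet> w \<le> \<epsilon> \<parallel>w\<parallel>\<close> for every \<open>\<epsilon> > 0\<close>.
\<close>

lemma regular_normal_inner_tangent_nonpos:
  fixes C :: "'a::euclidean_space set"
  assumes v: "v \<in> regular_normal_cone C p" and w: "quadratic_tangent C p w"
  shows "v \<bullet> w \<le> 0"
proof -
  obtain K0 where K0: "\<And>t. 0 < t \<Longrightarrow> t \<le> 1 \<Longrightarrow> \<exists>c\<in>C. norm (c - p - t *\<^sub>R w) \<le> K0 * t\<^sup>2"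
    using w unfolding quadratic_tangent_def by blast
  define K where "K = \<bar>K0\<bar>"
  have K: "\<exists>c\<in>C. norm (c - p - t *\<^sub>R w) \<le> K * t\<^sup>2" if t: "0 < t" "t \<le> 1" for t
  proof -
    have "K0 * t\<^sup>2 \<le> K * t\<^sup>2"
      unfolding K_def by (intro mult_right_mono) auto
    then show ?thesis
      using K0[OF t] by force
  qed
  have "K \<ge> 0" by (simp add: K_def)
  have bound: "v \<bullet> w \<le> \<epsilon> * norm w" if "\<epsilon> > 0" for \<epsilon>
  proof -
    obtain \<delta> where \<delta>: "\<delta> > 0"
      "\<And>x. x \<in> C \<Longrightarrow> norm (x - p) < \<delta> \<Longrightarrow> v \<bullet> (x - p) \<le> \<epsilon> * norm (x - p)"
      using v \<open>\<epsilon> > 0\<close> unfolding regular_normal_cone_iff by blast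
    have step: "v \<bullet> w \<le> \<epsilon> * norm w + (\<epsilon> + norm v) * K * t"
      if t: "0 < t" "t \<le> 1" "t * (norm w + K) < \<delta>" for t
    proof -
      obtain c where c: "c \<in> C" "norm (c - p - t *\<^sub>R w) \<le> K * t\<^sup>2"
        using K t by blast
      have n: "norm (c - p) \<le> t * norm w + K * t\<^sup>2"
        using norm_triangle_ineq[of "c - p - t *\<^sub>R w" "t *\<^sub>R w"] c(2) t(1) by simp
      have "K * t\<^sup>2 \<le> K * t"
        using t \<open>K \<ge> 0\<close> by (intro mult_left_mono) (auto simp: power2_eq_square mult_left_le)
      then have "norm (c - p) < \<delta>"
        using n t(3) by (simp add: algebra_simps)
      then have "v \<bullet> (c - p) \<le> \<epsilon> * norm (c - p)"
        using \<delta>(2) c(1) by blast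
      also have "\<dots> \<le> \<epsilon> * (t * norm w + K * t\<^sup>2)"
        using n \<open>\<epsilon> > 0\<close> by simp
      finally have 1: "v \<bullet> (c - p) \<le> \<epsilon> * (t * norm w + K * t\<^sup>2)" .
      have "- (v \<bullet> (c - p - t *\<^sub>R w)) \<le> norm v * norm (c - p - t *\<^sub>R w)"
        using Cauchy_Schwarz_ineq2[of v "c - p - t *\<^sub>R w"] by linarith
      also have "\<dots> \<le> norm v * (K * t\<^sup>2)"
        using c(2) by (intro mult_left_mono) auto
      finally have 2: "- (v \<bullet> (c - p - t *\<^sub>R w)) \<le> norm v * (K * t\<^sup>2)" .
      have "t * (v \<bullet> w) = v \<bullet> (c - p) - v \<bullet> (c - p - t *\<^sub>R w)"
        by (simp add: inner_diff_right)
      also have "\<dots> \<le> t * (\<epsilon> * norm w + (\<epsilon> + norm v) * K * t)"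
        using 1 2 by (simp add: algebra_simps power2_eq_square)
      finally show ?thesis
        using t(1) by simp
    qed
    have lim: "((\<lambda>t. \<epsilon> * norm w + (\<epsilon> + norm v) * K * t) \<longlongrightarrow> \<epsilon> * norm w) (at_right 0)"
      by (auto intro!: tendsto_eq_intros)
    have "((\<lambda>t. t * (norm w + K)) \<longlongrightarrow> 0) (at_right 0)"
      by (auto intro!: tendsto_eq_intros)
    then have "\<forall>\<^sub>F t in at_right 0. t * (norm w + K) < \<delta>"
      using \<delta>(1) by (rule order_tendstoD)
    moreover have "\<forall>\<^sub>F t in at_right (0::real). 0 < t \<and> t \<le> 1"
      unfolding eventually_at_right_field by (intro exI[of _ 1]) auto
    ultimately have "\<forall>\<^sub>F t in at_right 0. v \<bullet> w \<le> \<epsilon> * norm w + (\<epsilon> + norm v) * K * t"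
      by eventually_elim (use step in auto)
    then show ?thesis
      by (rule tendsto_lowerbound[OF lim]) simp
  qed
  have "v \<bullet> w \<le> 0 + \<epsilon>" if "\<epsilon> > 0" for \<epsilon>
  proof -
    have "v \<bullet> w \<le> \<epsilon> / (norm w + 1) * norm w"
      by (rule bound) (use that in \<open>simp add: add_nonneg_pos\<close>)
    also have "\<dots> \<le> \<epsilon>"
      using that by (simp add: pos_divide_le_eq add_nonneg_pos distrib_left)
    finally show ?thesis by simp
  qed
  then show ?thesis
    by (rule field_le_epsilon)
qed

lemma regular_eq_proximal_if_quadratically_approximable:
  fixes C :: "'a::euclidean_space set"
  assumes "quadratically_approximable C p"
  shows "regular_normal_cone C p = proximal_normal_cone C p"
proof (rule antisym[OF _ proximal_subset_regular], rule subsetI)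
  fix v assume v: "v \<in> regular_normal_cone C p"
  obtain \<delta> M where \<delta>: "\<delta> > 0" and M: "\<And>q. q \<in> C \<Longrightarrow> norm (q - p) < \<delta> \<Longrightarrow>
      \<exists>w. quadratic_tangent C p w \<and> norm (q - p - w) \<le> M * (norm (q - p))\<^sup>2"
    using assms unfolding quadratically_approximable_def by blast
  define N where "N = norm v * \<bar>M\<bar> + norm v / \<delta> + 1"
  have "v \<bullet> (q - p) \<le> N * (norm (q - p))\<^sup>2" if q: "q \<in> C" for q
  proof (cases "norm (q - p) < \<delta>")
    case True
    then obtain w where w: "quadratic_tangent C p w" "norm (q - p - w) \<le> M * (norm (q - p))\<^sup>2"
      using M q by blast
    have "v \<bullet> (q - p) = v \<bullet> w + v \<bullet> (q - p - w)"
      by (simp add: inner_diff_right)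
    also have "\<dots> \<le> 0 + norm v * norm (q - p - w)"
      using regular_normal_inner_tangent_nonpos[OF v w(1)] norm_cauchy_schwarz by (rule add_mono)
    also have "\<dots> \<le> norm v * (M * (norm (q - p))\<^sup>2)"
      using w(2) by (simp add: mult_left_mono)
    also have "\<dots> = (norm v * M) * (norm (q - p))\<^sup>2"
      by simp
    also have "\<dots> \<le> N * (norm (q - p))\<^sup>2"
    proof (rule mult_right_mono)
      have "norm v * M \<le> norm v * \<bar>M\<bar>" by (intro mult_left_mono) auto
      then show "norm v * M \<le> N"
        unfolding N_def using \<delta> by (simp add: add_increasing2)
    qed simp
    finally show ?thesis .
  next
    case False
    have "v \<bullet> (q - p) \<le> norm v * norm (q - p)"
      by (rule norm_cauchy_schwarz)
    also have "\<dots> = norm v / \<delta> * (\<delta> * norm (q - p))"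
      using \<delta> by simp
    also have "\<dots> \<le> norm v / \<delta> * (norm (q - p))\<^sup>2"
      using False \<delta> by (intro mult_left_mono) (auto simp: power2_eq_square mult_right_mono)
    also have "\<dots> \<le> N * (norm (q - p))\<^sup>2"
      unfolding N_def by (intro mult_right_mono) auto
    finally show ?thesis .
  qed
  moreover have "N > 0"
    unfolding N_def using \<delta> by (simp add: add_nonneg_pos)
  ultimately show "v \<in> proximal_normal_cone C p"
    unfolding proximal_normal_cone_def by blast
qed

lemma quadratic_tangent_segment:
  assumes "\<And>t. 0 < t \<Longrightarrow> t \<le> 1 \<Longrightarrow> p + t *\<^sub>R (q - p) \<in> C"
  shows "quadratic_tangent C p (q - p)"
  unfolding quadratic_tangent_def
proof (intro exI[of _ 0] allI impI)
  fix t :: real assume "0 < t \<and> t \<le> 1"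
  then show "\<exists>c\<in>C. norm (c - p - t *\<^sub>R (q - p)) \<le> 0 * t\<^sup>2"
    by (intro bexI[of _ "p + t *\<^sub>R (q - p)"]) (auto simp: assms)
qed

lemma quadratically_approximable_if_locally_starlike:
  assumes "\<delta> > 0"
    and "\<And>q t. q \<in> C \<Longrightarrow> norm (q - p) < \<delta> \<Longrightarrow> 0 < t \<Longrightarrow> t \<le> 1 \<Longrightarrow> p + t *\<^sub>R (q - p) \<in> C"
  shows "quadratically_approximable C p"
proof -
  have "quadratic_tangent C p (q - p) \<and> norm (q - p - (q - p)) \<le> 0 * (norm (q - p))\<^sup>2"
    if "q \<in> C" "norm (q - p) < \<delta>" for q
    using quadratic_tangent_segment[of p q C] assms(2) that by simp
  then show ?thesis
    unfolding quadratically_approximable_def using assms(1) by blast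
qed

lemma quadratically_approximable_swap:
  fixes C :: "('a::real_normed_vector \<times> 'a) set"
  assumes sym: "\<And>x y. (x, y) \<in> C \<Longrightarrow> (y, x) \<in> C"
    and "quadratically_approximable C (x, y)"
  shows "quadratically_approximable C (y, x)"
proof -
  have norm_swap: "norm (prod.swap z) = norm z" for z :: "'a \<times> 'a"
    by (cases z) (simp add: norm_Pair add.commute)
  have swap_diff: "prod.swap (a - b) = prod.swap a - prod.swap b" for a b :: "'a \<times> 'a"
    by (cases a, cases b) simp
  have swap_scale: "prod.swap (t *\<^sub>R a) = t *\<^sub>R prod.swap a" for a :: "'a \<times> 'a" and t
    by (cases a) simp
  have swap_mem: "prod.swap c \<in> C" if "c \<in> C" for c
    using that sym by (cases c) auto
  have tangent: "quadratic_tangent C (y, x) (prod.swap w)" if "quadratic_tangent C (x, y) w" for w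
  proof -
    obtain K where K: "\<And>t. 0 < t \<Longrightarrow> t \<le> 1 \<Longrightarrow> \<exists>c\<in>C. norm (c - (x, y) - t *\<^sub>R w) \<le> K * t\<^sup>2"
      using \<open>quadratic_tangent C (x, y) w\<close> unfolding quadratic_tangent_def by blast
    have "\<exists>c\<in>C. norm (c - (y, x) - t *\<^sub>R prod.swap w) \<le> K * t\<^sup>2" if t: "0 < t" "t \<le> 1" for t
    proof -
      obtain c where c: "c \<in> C" "norm (c - (x, y) - t *\<^sub>R w) \<le> K * t\<^sup>2"
        using K[OF t] by blast
      have "prod.swap c - (y, x) - t *\<^sub>R prod.swap w = prod.swap (c - (x, y) - t *\<^sub>R w)"
        by (simp add: swap_diff swap_scale)
      then show ?thesis
        using c swap_mem by (metis norm_swap)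
    qed
    then show ?thesis
      unfolding quadratic_tangent_def by blast
  qed
  obtain \<delta> M where \<delta>: "\<delta> > 0" and M: "\<And>q. q \<in> C \<Longrightarrow> norm (q - (x, y)) < \<delta> \<Longrightarrow>
      \<exists>w. quadratic_tangent C (x, y) w \<and> norm (q - (x, y) - w) \<le> M * (norm (q - (x, y)))\<^sup>2"
    using assms(2) unfolding quadratically_approximable_def by blast
  have "\<exists>w. quadratic_tangent C (y, x) w \<and> norm (q - (y, x) - w) \<le> M * (norm (q - (y, x)))\<^sup>2"
    if q: "q \<in> C" "norm (q - (y, x)) < \<delta>" for q
  proof -
    have eq: "prod.swap q - (x, y) = prod.swap (q - (y, x))"
      by (simp add: swap_diff)
    obtain w where w: "quadratic_tangent C (x, y) w"
      "norm (prod.swap q - (x, y) - w) \<le> M * (norm (prod.swap q - (x, y)))\<^sup>2"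
      using M[of "prod.swap q"] swap_mem[OF q(1)] q(2) unfolding eq norm_swap by blast
    have "q - (y, x) - prod.swap w = prod.swap (prod.swap q - (x, y) - w)"
      by (simp add: swap_diff)
    then have "norm (q - (y, x) - prod.swap w) \<le> M * (norm (q - (y, x)))\<^sup>2"
      using w(2) by (metis eq norm_swap)
    then show ?thesis
      using tangent[OF w(1)] by blast
  qed
  then show ?thesis
    unfolding quadratically_approximable_def using \<delta> by blast
qed

section \<open>Complementary pairs in a second-order cone\<close>

text \<open>
  The cone is described here without coordinates, by a unit vector \<open>e\<close> spanning its axis; every
  computation then reduces to inner products with \<open>e\<close> and the orthogonal remainder.
\<close>

definition off_axis :: "'a::real_inner \<Rightarrow> 'a \<Rightarrow> 'a" where
  "off_axis e x = x - (x \<bullet> e) *\<^sub>R e"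

definition axis_cone :: "'a::real_inner \<Rightarrow> 'a set" where
  "axis_cone e = {x. norm (off_axis e x) \<le> x \<bullet> e}"

definition complementary_pairs :: "'a::real_inner \<Rightarrow> ('a \<times> 'a) set" where
  "complementary_pairs e = {(x, y). x \<in> axis_cone e \<and> y \<in> axis_cone e \<and> x \<bullet> y = 0}"

lemma decompose_off_axis: "x = (x \<bullet> e) *\<^sub>R e + off_axis e x"
  by (simp add: off_axis_def)

lemma off_axis_add: "off_axis e (x + y) = off_axis e x + off_axis e y"
  by (simp add: off_axis_def inner_add_left scaleR_add_left)

lemma off_axis_diff: "off_axis e (x - y) = off_axis e x - off_axis e y"
  by (simp add: off_axis_def inner_diff_left scaleR_diff_left)

lemma off_axis_scaleR: "off_axis e (c *\<^sub>R x) = c *\<^sub>R off_axis e x"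
  by (simp add: off_axis_def scaleR_diff_right)

lemma axis_cone_zero [simp]: "0 \<in> axis_cone e"
  by (simp add: axis_cone_def off_axis_def)

lemma axis_cone_add: "x \<in> axis_cone e \<Longrightarrow> y \<in> axis_cone e \<Longrightarrow> x + y \<in> axis_cone e"
  unfolding axis_cone_def mem_Collect_eq off_axis_add inner_add_left
  by (rule order_trans[OF norm_triangle_ineq add_mono])

lemma axis_cone_scaleR: "x \<in> axis_cone e \<Longrightarrow> c \<ge> 0 \<Longrightarrow> c *\<^sub>R x \<in> axis_cone e"
  by (simp add: axis_cone_def off_axis_scaleR mult_left_mono)

lemma complementary_pairs_sym: "(x, y) \<in> complementary_pairs e \<Longrightarrow> (y, x) \<in> complementary_pairs e"
  by (simp add: complementary_pairs_def inner_commute)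

lemma complementary_pairs_segment_zero:
  assumes "(x, 0) \<in> complementary_pairs e" "(x', 0) \<in> complementary_pairs e" "0 < t" "t \<le> 1"
  shows "(x, 0) + t *\<^sub>R ((x', 0) - (x, 0)) \<in> complementary_pairs e"
proof -
  have "x + t *\<^sub>R (x' - x) = (1 - t) *\<^sub>R x + t *\<^sub>R x'"
    by (simp add: algebra_simps)
  moreover have "\<dots> \<in> axis_cone e"
    using assms by (intro axis_cone_add axis_cone_scaleR) (auto simp: complementary_pairs_def)
  ultimately show ?thesis
    by (simp add: complementary_pairs_def)
qed

text \<open>
  With \<open>u\<close> orthogonal to \<open>e\<close>, the first component runs over the boundary of the cone and, for \<open>s \<ge> 0\<close>, the second
  over the ray that is complementary to it.
\<close>

definition boundary_pair :: "'a::real_inner \<Rightarrow> 'a \<Rightarrow> real \<Rightarrow> 'a \<times> 'a" where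
  "boundary_pair e u s = (norm u *\<^sub>R e + u, s *\<^sub>R (norm u *\<^sub>R e - u))"

definition boundary_pair_deriv :: "'a::real_inner \<Rightarrow> 'a \<Rightarrow> real \<Rightarrow> 'a \<Rightarrow> real \<Rightarrow> 'a \<times> 'a" where
  "boundary_pair_deriv e u s d r =
     (((u \<bullet> d) / norm u) *\<^sub>R e + d,
      s *\<^sub>R (((u \<bullet> d) / norm u) *\<^sub>R e - d) + r *\<^sub>R (norm u *\<^sub>R e - u))"

text \<open>
  The lower bound is the Cauchy--Schwarz inequality for \<open>u\<close> and \<open>u + d\<close>, the upper bound the
  inequality \<open>2 \<parallel>u\<parallel> \<parallel>u + d\<parallel> \<le> \<parallel>u\<parallel>\<^sup>2 + \<parallel>u + d\<parallel>\<^sup>2\<close>.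
\<close>

lemma norm_first_order_remainder:
  fixes u d :: "'a::real_inner"
  assumes "u \<noteq> 0"
  shows "0 \<le> norm (u + d) - norm u - (u \<bullet> d) / norm u"
    and "norm (u + d) - norm u - (u \<bullet> d) / norm u \<le> (norm d)\<^sup>2 / (2 * norm u)"
proof -
  have pos: "norm u > 0" using assms by simp
  have "u \<bullet> (u + d) \<le> norm u * norm (u + d)"
    by (rule norm_cauchy_schwarz)
  then have "norm u * norm u + u \<bullet> d \<le> norm u * norm (u + d)"
    by (simp add: inner_add_right dot_square_norm power2_eq_square)
  then show "0 \<le> norm (u + d) - norm u - (u \<bullet> d) / norm u"
    using pos by (simp add: field_simps)
  have "0 \<le> (norm (u + d) - norm u)\<^sup>2" by simp
  then have "2 * norm u * norm (u + d) \<le> (norm (u + d))\<^sup>2 + (norm u)\<^sup>2"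
    by (simp add: power2_diff algebra_simps)
  moreover have "(norm (u + d))\<^sup>2 = (norm u)\<^sup>2 + 2 * (u \<bullet> d) + (norm d)\<^sup>2"
    by (simp add: power2_norm_eq_inner inner_add_left inner_add_right inner_commute)
  ultimately have "2 * norm u * norm (u + d) \<le> 2 * (norm u * norm u) + 2 * (u \<bullet> d) + (norm d)\<^sup>2"
    by (simp add: power2_eq_square)
  then have "2 * norm u * (norm (u + d) - norm u - (u \<bullet> d) / norm u) \<le> (norm d)\<^sup>2"
    using pos by (simp add: right_diff_distrib)
  then show "norm (u + d) - norm u - (u \<bullet> d) / norm u \<le> (norm d)\<^sup>2 / (2 * norm u)"
    using pos by (simp add: pos_le_divide_eq mult.commute)
qed

lemma boundary_pair_expansion:
  fixes e u d :: "'a::real_inner"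
  assumes e: "norm e = 1" and u: "u \<noteq> 0" and s: "s \<ge> 0"
  shows "norm (boundary_pair e (u + d) (s + r) - boundary_pair e u s - boundary_pair_deriv e u s d r)
    \<le> (1 + s) * (norm d)\<^sup>2 / (2 * norm u) + 2 * \<bar>r\<bar> * norm d"
proof -
  define \<eta> where "\<eta> = norm (u + d) - norm u - (u \<bullet> d) / norm u"
  have \<eta>: "0 \<le> \<eta>" "\<eta> \<le> (norm d)\<^sup>2 / (2 * norm u)"
    unfolding \<eta>_def by (rule norm_first_order_remainder[OF u])+
  let ?b = "(s * \<eta>) *\<^sub>R e + r *\<^sub>R ((norm (u + d) - norm u) *\<^sub>R e - d)"
  have "boundary_pair e (u + d) (s + r) - boundary_pair e u s - boundary_pair_deriv e u s d r
    = (\<eta> *\<^sub>R e, ?b)"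
    by (simp add: boundary_pair_def boundary_pair_deriv_def \<eta>_def algebra_simps)
  moreover have "norm (\<eta> *\<^sub>R e, ?b) \<le> norm (\<eta> *\<^sub>R e) + norm ?b"
    by (rule norm_Pair_le)
  moreover have "norm (\<eta> *\<^sub>R e) = \<eta>"
    using e \<eta>(1) by simp
  moreover have "norm ?b \<le> s * \<eta> + \<bar>r\<bar> * (2 * norm d)"
  proof (rule norm_triangle_le, rule add_mono)
    show "norm ((s * \<eta>) *\<^sub>R e) \<le> s * \<eta>"
      using e s \<eta>(1) by simp
    have "norm ((norm (u + d) - norm u) *\<^sub>R e - d) \<le> \<bar>norm (u + d) - norm u\<bar> + norm d"
      using norm_triangle_ineq4[of "(norm (u + d) - norm u) *\<^sub>R e" d] e by simp
    also have "\<dots> \<le> 2 * norm d"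
      using norm_triangle_ineq3[of "u + d" u] by simp
    finally show "norm (r *\<^sub>R ((norm (u + d) - norm u) *\<^sub>R e - d)) \<le> \<bar>r\<bar> * (2 * norm d)"
      by (simp add: mult_left_mono)
  qed
  moreover have "(1 + s) * \<eta> \<le> (1 + s) * ((norm d)\<^sup>2 / (2 * norm u))"
    using \<eta>(2) s by (intro mult_left_mono) auto
  ultimately show ?thesis
    by (simp add: algebra_simps)
qed

lemma norm_fst_diff_le: "norm (fst q - fst p) \<le> norm (q - p)"
  by (metis fst_diff norm_fst_le prod.collapse)

lemma norm_snd_diff_le: "norm (snd q - snd p) \<le> norm (q - p)"
  by (metis snd_diff norm_snd_le prod.collapse)

context
  fixes e :: "'a::real_inner"
  assumes e: "norm e = 1"
begin

lemma inner_axis_self [simp]: "e \<bullet> e = 1"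
  using e by (simp add: dot_square_norm)

lemma off_axis_axis [simp]: "off_axis e e = 0"
  by (simp add: off_axis_def)

lemma off_axis_orthogonal: "u \<bullet> e = 0 \<Longrightarrow> off_axis e u = u"
  by (simp add: off_axis_def)

lemma inner_off_axis_axis: "off_axis e x \<bullet> e = 0"
  by (simp add: off_axis_def inner_diff_left)

lemma inner_axis_decomposition: "x \<bullet> y = (x \<bullet> e) * (y \<bullet> e) + off_axis e x \<bullet> off_axis e y"
  by (simp add: off_axis_def inner_diff_left inner_diff_right inner_commute)

lemma norm_off_axis_le: "norm (off_axis e x) \<le> norm x"
proof (rule power2_le_imp_le)
  show "(norm (off_axis e x))\<^sup>2 \<le> (norm x)\<^sup>2"
    using inner_axis_decomposition[of x x] by (simp add: power2_norm_eq_inner)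
qed simp

lemma abs_inner_axis_le: "\<bar>x \<bullet> e\<bar> \<le> norm x"
  using Cauchy_Schwarz_ineq2[of x e] e by simp

lemma axis_cone_inner_pos:
  assumes "x \<in> axis_cone e" "x \<noteq> 0"
  shows "x \<bullet> e > 0"
proof -
  have "norm (off_axis e x) \<le> x \<bullet> e"
    using assms by (simp add: axis_cone_def)
  moreover have "x \<bullet> e \<noteq> 0"
  proof
    assume 0: "x \<bullet> e = 0"
    then have "off_axis e x = 0" using calculation by simp
    then show False
      using 0 assms(2) decompose_off_axis[of x e] by simp
  qed
  ultimately show ?thesis
    using norm_ge_zero[of "off_axis e x"] by linarith
qed

lemma off_axis_boundary_pair:
  assumes "u \<bullet> e = 0"
  shows "off_axis e (fst (boundary_pair e u s)) = u"
    and "fst (boundary_pair e u s) \<bullet> e = norm u"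
    and "off_axis e (snd (boundary_pair e u s)) = - s *\<^sub>R u"
    and "snd (boundary_pair e u s) \<bullet> e = s * norm u"
  using assms
  by (simp_all add: boundary_pair_def off_axis_add off_axis_diff off_axis_scaleR
      off_axis_orthogonal inner_add_left inner_diff_left)

lemma boundary_pair_in_complementary_pairs:
  assumes u: "u \<bullet> e = 0" and s: "s \<ge> 0"
  shows "boundary_pair e u s \<in> complementary_pairs e"
proof -
  let ?x = "fst (boundary_pair e u s)" and ?y = "snd (boundary_pair e u s)"
  have "?x \<bullet> ?y = 0"
    unfolding inner_axis_decomposition[of ?x ?y] off_axis_boundary_pair[OF u]
    by (simp add: dot_square_norm power2_eq_square)
  moreover have "?x \<in> axis_cone e" "?y \<in> axis_cone e"
    unfolding axis_cone_def mem_Collect_eq off_axis_boundary_pair[OF u] using s by simp_all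
  ultimately show ?thesis
    unfolding complementary_pairs_def by (simp add: case_prod_beta)
qed

text \<open>
  Orthogonality turns the Cauchy--Schwarz inequality between the off-axis parts and both cone
  inequalities into equalities; so both elements lie on the boundary and their off-axis parts point
  in opposite directions.
\<close>

lemma complementary_nonzeroE:
  assumes "(x, y) \<in> complementary_pairs e" "x \<noteq> 0" "y \<noteq> 0"
  obtains u s where "u \<bullet> e = 0" "u \<noteq> 0" "s > 0" "(x, y) = boundary_pair e u s"
proof -
  define a b u w where "a = x \<bullet> e" and "b = y \<bullet> e" and "u = off_axis e x" and "w = off_axis e y"
  have x: "x \<in> axis_cone e" and y: "y \<in> axis_cone e" and xy: "x \<bullet> y = 0"
    using assms(1) by (auto simp: complementary_pairs_def)
  have ab: "a > 0" "b > 0"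
    unfolding a_def b_def using axis_cone_inner_pos x y assms by auto
  have ua: "norm u \<le> a" and wb: "norm w \<le> b"
    using x y by (auto simp: axis_cone_def a_def b_def u_def w_def)
  have sum0: "a * b + u \<bullet> w = 0"
    using inner_axis_decomposition[of x y] xy by (simp add: a_def b_def u_def w_def)
  have cs: "- (u \<bullet> w) \<le> norm u * norm w"
    using Cauchy_Schwarz_ineq2[of u w] by linarith
  have "a * b \<le> norm u * norm w" using sum0 cs by linarith
  also have "\<dots> \<le> norm u * b" using wb by (simp add: mult_left_mono)
  finally have "a \<le> norm u" using ab by simp
  then have ua: "norm u = a" using ua by simp
  have "a * b \<le> a * norm w" using sum0 cs ua by simp
  then have wb: "norm w = b" using wb ab by simp
  have "- u \<bullet> w = norm (- u) * norm w"
    using sum0 ua wb by simp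
  then have "norm (- u) *\<^sub>R w = norm w *\<^sub>R (- u)"
    unfolding norm_cauchy_schwarz_eq .
  then have "a *\<^sub>R w = - (b *\<^sub>R u)"
    using ua wb by simp
  then have "(1 / a) *\<^sub>R (a *\<^sub>R w) = (1 / a) *\<^sub>R (- (b *\<^sub>R u))"
    by simp
  then have w: "w = - (b / a) *\<^sub>R u"
    using ab by simp
  have "(x, y) = boundary_pair e u (b / a)"
    using decompose_off_axis[of x e] decompose_off_axis[of y e] w ab ua
    by (simp add: boundary_pair_def a_def[symmetric] b_def[symmetric] u_def[symmetric]
        w_def[symmetric] scaleR_diff_right)
  moreover have "u \<bullet> e = 0"
    unfolding u_def by (rule inner_off_axis_axis)
  ultimately show ?thesis
    using that[of u "b / a"] ab ua by auto
qed

section \<open>Quadratic approximation at each base point\<close>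

lemma quadratic_tangent_boundary_pair_deriv:
  assumes u: "u \<bullet> e = 0" "u \<noteq> 0" and u': "u' \<bullet> e = 0" and s: "s \<ge> 0" "s' \<ge> 0"
  shows "quadratic_tangent (complementary_pairs e) (boundary_pair e u s)
    (boundary_pair_deriv e u s (u' - u) (s' - s))"
proof -
  define d r where "d = u' - u" and "r = s' - s"
  let ?p = "boundary_pair e u s" and ?w = "boundary_pair_deriv e u s d r"
  let ?K = "(1 + s) * (norm d)\<^sup>2 / (2 * norm u) + 2 * \<bar>r\<bar> * norm d"
  have "\<exists>c\<in>complementary_pairs e. norm (c - ?p - t *\<^sub>R ?w) \<le> ?K * t\<^sup>2" if t: "0 < t" "t \<le> 1" for t
  proof (rule bexI)
    have "t *\<^sub>R ?w = boundary_pair_deriv e u s (t *\<^sub>R d) (t * r)"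
      by (simp add: boundary_pair_deriv_def algebra_simps)
    moreover have "(1 + s) * (norm (t *\<^sub>R d))\<^sup>2 / (2 * norm u) + 2 * \<bar>t * r\<bar> * norm (t *\<^sub>R d) = ?K * t\<^sup>2"
      using t(1) by (simp add: abs_mult power2_eq_square algebra_simps)
    ultimately show "norm (boundary_pair e (u + t *\<^sub>R d) (s + t * r) - ?p - t *\<^sub>R ?w) \<le> ?K * t\<^sup>2"
      using boundary_pair_expansion[OF e u(2) s(1), of "t *\<^sub>R d" "t * r"] by simp
    have "s + t * r = (1 - t) * s + t * s'"
      by (simp add: r_def algebra_simps)
    also have "\<dots> \<ge> 0"
      using t s by simp
    finally have "s + t * r \<ge> 0" .
    moreover have "(u + t *\<^sub>R d) \<bullet> e = 0"
      using u(1) u' by (simp add: d_def inner_add_left inner_diff_left)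
    ultimately show "boundary_pair e (u + t *\<^sub>R d) (s + t * r) \<in> complementary_pairs e"
      by (intro boundary_pair_in_complementary_pairs)
  qed
  then show ?thesis
    unfolding quadratic_tangent_def d_def r_def by blast
qed

text \<open>
  The off-axis projection recovers \<open>u\<close>. The slope \<open>s\<close> is a quotient of axial components, whose
  denominator \<open>\<parallel>u'\<parallel>\<close> stays above \<open>\<parallel>u\<parallel> / 2\<close> on the given neighbourhood.
\<close>

lemma boundary_pair_parameters_Lipschitz:
  fixes s s' :: real
  assumes u: "u \<bullet> e = 0" and u': "u' \<bullet> e = 0" and s: "s \<ge> 0" and "u \<noteq> 0"
  defines "D \<equiv> norm (boundary_pair e u' s' - boundary_pair e u s)"
  assumes near: "D < norm u / 2"
  shows "norm (u' - u) \<le> D" and "\<bar>s' - s\<bar> \<le> 2 * (1 + s) / norm u * D"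
proof -
  let ?q = "boundary_pair e u' s'" and ?p = "boundary_pair e u s"
  have fst_le: "norm (fst ?q - fst ?p) \<le> D"
    unfolding D_def using norm_fst_diff_le .
  have snd_le: "norm (snd ?q - snd ?p) \<le> D"
    unfolding D_def using norm_snd_diff_le .
  have "norm (u' - u) = norm (off_axis e (fst ?q - fst ?p))"
    unfolding off_axis_diff off_axis_boundary_pair[OF u] off_axis_boundary_pair[OF u'] ..
  also have "\<dots> \<le> D"
    using norm_off_axis_le fst_le by (rule order_trans)
  finally show "norm (u' - u) \<le> D" .
  have a: "\<bar>norm u' - norm u\<bar> \<le> D"
    using order_trans[OF abs_inner_axis_le fst_le]
    by (simp add: inner_diff_left off_axis_boundary_pair[OF u] off_axis_boundary_pair[OF u'])
  have b: "\<bar>s' * norm u' - s * norm u\<bar> \<le> D"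
    using order_trans[OF abs_inner_axis_le snd_le]
    by (simp add: inner_diff_left off_axis_boundary_pair[OF u] off_axis_boundary_pair[OF u'])
  have half: "norm u / 2 \<le> norm u'"
    using a near by linarith
  have "\<bar>s' - s\<bar> * (norm u / 2) \<le> \<bar>s' - s\<bar> * norm u'"
    using half by (intro mult_left_mono) auto
  also have "\<dots> = \<bar>(s' - s) * norm u'\<bar>"
    by (simp add: abs_mult)
  also have "\<dots> = \<bar>(s' * norm u' - s * norm u) - s * (norm u' - norm u)\<bar>"
    by (simp add: algebra_simps)
  also have "\<dots> \<le> \<bar>s' * norm u' - s * norm u\<bar> + \<bar>s * (norm u' - norm u)\<bar>"
    by (rule abs_triangle_ineq4)
  also have "\<dots> \<le> D + s * D"
    using a b s by (intro add_mono) (auto simp: abs_mult mult_left_mono)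
  finally show "\<bar>s' - s\<bar> \<le> 2 * (1 + s) / norm u * D"
    using \<open>u \<noteq> 0\<close> by (simp add: field_simps)
qed

lemma quadratically_approximable_boundary:
  assumes u: "u \<bullet> e = 0" "u \<noteq> 0" and s: "s \<ge> 0"
  shows "quadratically_approximable (complementary_pairs e) (boundary_pair e u s)"
proof -
  let ?p = "boundary_pair e u s" and ?C = "complementary_pairs e"
  define y where "y = snd ?p"
  \<comment> \<open>If \<open>y\<close> is nonzero, the radius keeps the second component nonzero as well.\<close>
  define \<delta> where "\<delta> = min (norm u / 2) (if y = 0 then 1 else norm y)"
  define L where "L = 2 * (1 + s) / norm u"
  define M where "M = (1 + s) / (2 * norm u) + 2 * L"
  have "\<delta> > 0" using u by (simp add: \<delta>_def)
  have "L \<ge> 0" unfolding L_def using s by simp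
  then have "M \<ge> 0" unfolding M_def using s by simp
  have "\<exists>w. quadratic_tangent ?C ?p w \<and> norm (q - ?p - w) \<le> M * (norm (q - ?p))\<^sup>2"
    if q: "q \<in> ?C" "norm (q - ?p) < \<delta>" for q
  proof -
    obtain x' y' where q': "q = (x', y')" by (cases q)
    have fst_le: "norm (x' - fst ?p) \<le> norm (q - ?p)"
      using norm_fst_diff_le[of q ?p] by (simp add: q')
    have snd_le: "norm (y' - y) \<le> norm (q - ?p)"
      using norm_snd_diff_le[of q ?p] by (simp add: q' y_def)
    have "x' \<noteq> 0"
    proof
      assume "x' = 0"
      then have "norm u \<le> norm (x' - fst ?p)"
        using norm_off_axis_le[of "fst ?p"] off_axis_boundary_pair(1)[OF u(1), of s] by simp
      moreover have "norm u > 0" using u(2) by simp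
      ultimately show False
        using fst_le q(2) unfolding \<delta>_def by linarith
    qed
    show ?thesis
    proof (cases "y' = 0")
      case True
      have "y = 0"
      proof (rule ccontr)
        assume "y \<noteq> 0"
        then show False
          using snd_le q(2) True by (simp add: \<delta>_def)
      qed
      then obtain x where p: "?p = (x, 0)"
        unfolding y_def by (metis prod.collapse)
      have "(x, 0) \<in> ?C"
        using boundary_pair_in_complementary_pairs[OF u(1) s] p by simp
      moreover have "(x', 0) \<in> ?C"
        using q(1) q' True by simp
      ultimately have "quadratic_tangent ?C ?p (q - ?p)"
        unfolding p q' True
        by (intro quadratic_tangent_segment complementary_pairs_segment_zero)
      then show ?thesis
        using \<open>M \<ge> 0\<close> by (intro exI[of _ "q - ?p"]) simp
    next
      case False
      then obtain u' s' where u': "u' \<bullet> e = 0" and s': "s' > 0" and qp: "q = boundary_pair e u' s'"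
        using complementary_nonzeroE q(1) q' \<open>x' \<noteq> 0\<close> by metis
      let ?D = "norm (q - ?p)" and ?w = "boundary_pair_deriv e u s (u' - u) (s' - s)"
      have "?D < norm u / 2" using q(2) by (simp add: \<delta>_def)
      then have d: "norm (u' - u) \<le> ?D" and r: "\<bar>s' - s\<bar> \<le> L * ?D"
        using boundary_pair_parameters_Lipschitz[OF u(1) u' s u(2)] by (auto simp: qp L_def)
      have "norm (q - ?p - ?w)
          \<le> (1 + s) * (norm (u' - u))\<^sup>2 / (2 * norm u) + 2 * \<bar>s' - s\<bar> * norm (u' - u)"
        using boundary_pair_expansion[OF e u(2) s, of "u' - u" "s' - s"] by (simp add: qp)
      also have "\<dots> \<le> (1 + s) * ?D\<^sup>2 / (2 * norm u) + 2 * (L * ?D) * ?D"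
        using d r s \<open>L \<ge> 0\<close>
        by (intro add_mono divide_right_mono mult_left_mono mult_mono power_mono) auto
      also have "\<dots> = M * ?D\<^sup>2"
        by (simp add: M_def power2_eq_square algebra_simps)
      finally show ?thesis
        using quadratic_tangent_boundary_pair_deriv[OF u u' s] s' by (intro exI[of _ ?w]) simp
    qed
  qed
  then show ?thesis
    unfolding quadratically_approximable_def using \<open>\<delta> > 0\<close> by blast
qed

text \<open>
  An interior first component forces the second one to vanish, and this persists nearby; so the
  set is locally the convex set of pairs \<open>(x', 0)\<close>.
\<close>

lemma quadratically_approximable_interior:
  assumes "norm (off_axis e x) < x \<bullet> e"
  shows "quadratically_approximable (complementary_pairs e) (x, 0)"
proof (rule quadratically_approximable_if_locally_starlike)
  \<comment> \<open>Both sides of the cone inequality are 1-Lipschitz, so half the slack is a safe radius.\<close>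
  define \<delta> where "\<delta> = (x \<bullet> e - norm (off_axis e x)) / 2"
  show "\<delta> > 0" using assms by (simp add: \<delta>_def)
  fix q :: "'a \<times> 'a" and t :: real
  assume q: "q \<in> complementary_pairs e" "norm (q - (x, 0)) < \<delta>" and t: "0 < t" "t \<le> 1"
  obtain x' y' where q': "q = (x', y')" by (cases q)
  have near: "norm (x' - x) < \<delta>"
    using norm_fst_le[of "x' - x" y'] q(2) by (simp add: q')
  have "norm (off_axis e x') \<le> norm (off_axis e x) + norm (x' - x)"
    using norm_triangle_ineq2[of "off_axis e x'" "off_axis e x"] norm_off_axis_le[of "x' - x"]
    by (simp add: off_axis_diff)
  moreover have "x \<bullet> e - x' \<bullet> e \<le> norm (x' - x)"
    using abs_inner_axis_le[of "x' - x"] by (simp add: inner_diff_left)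
  ultimately have strict: "norm (off_axis e x') < x' \<bullet> e"
    using near unfolding \<delta>_def by (simp add: field_simps)
  then have "x' \<noteq> 0" by (auto simp: off_axis_def)
  have "y' = 0"
  proof (rule ccontr)
    assume "y' \<noteq> 0"
    then obtain u s where us: "u \<bullet> e = 0" "(x', y') = boundary_pair e u s"
      using complementary_nonzeroE q(1) q' \<open>x' \<noteq> 0\<close> by metis
    then have "x' = fst (boundary_pair e u s)" by (metis fst_conv)
    then show False
      using strict off_axis_boundary_pair[OF us(1), of s] by simp
  qed
  moreover have "(x, 0) \<in> complementary_pairs e"
    using assms by (simp add: complementary_pairs_def) (simp add: axis_cone_def)
  ultimately show "(x, 0) + t *\<^sub>R (q - (x, 0)) \<in> complementary_pairs e"
    using complementary_pairs_segment_zero q(1) q' t by metis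
qed

lemma quadratically_approximable_fst_nonzero:
  assumes xy: "(x, y) \<in> complementary_pairs e" and x: "x \<noteq> 0"
  shows "quadratically_approximable (complementary_pairs e) (x, y)"
proof (cases "y = 0")
  case False
  then show ?thesis
    using complementary_nonzeroE[OF xy x] quadratically_approximable_boundary less_imp_le by metis
next
  case True
  have cone: "x \<in> axis_cone e" using xy by (simp add: complementary_pairs_def)
  show ?thesis
  proof (cases "norm (off_axis e x) < x \<bullet> e")
    case True
    then show ?thesis
      using quadratically_approximable_interior \<open>y = 0\<close> by simp
  next
    case False
    then have n: "norm (off_axis e x) = x \<bullet> e"
      using cone by (simp add: axis_cone_def)
    then have "(x, y) = boundary_pair e (off_axis e x) 0"
      using decompose_off_axis[of x e] \<open>y = 0\<close> by (simp add: boundary_pair_def)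
    moreover have "off_axis e x \<noteq> 0"
      using n axis_cone_inner_pos[OF cone x] by auto
    ultimately show ?thesis
      using quadratically_approximable_boundary inner_off_axis_axis by simp
  qed
qed

lemma quadratically_approximable_complementary_pairs:
  assumes xy: "(x, y) \<in> complementary_pairs e"
  shows "quadratically_approximable (complementary_pairs e) (x, y)"
proof -
  consider "x \<noteq> 0" | "y \<noteq> 0" | "x = 0" "y = 0" by blast
  then show ?thesis
  proof cases
    case 1
    then show ?thesis
      using quadratically_approximable_fst_nonzero xy by blast
  next
    case 2
    then have "quadratically_approximable (complementary_pairs e) (y, x)"
      using quadratically_approximable_fst_nonzero complementary_pairs_sym xy by blast
    then show ?thesis
      by (intro quadratically_approximable_swap[of _ y x]) (auto intro: complementary_pairs_sym)
  next
    case 3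
    show ?thesis
      unfolding 3
    proof (rule quadratically_approximable_if_locally_starlike[OF zero_less_one])
      fix q :: "'a \<times> 'a" and t :: real
      assume "q \<in> complementary_pairs e" "0 < t"
      then show "(0, 0) + t *\<^sub>R (q - (0, 0)) \<in> complementary_pairs e"
        by (cases q) (auto simp: complementary_pairs_def intro!: axis_cone_scaleR)
    qed
  qed
qed

end

section \<open>The coordinate form\<close>

lemma second_order_cone_eq_axis_cone:
  fixes k :: "'m::finite"
  shows "second_order_cone k = axis_cone (axis k 1)"
proof -
  have "norm (off_axis (axis k 1) x) = L2_set (\<lambda>j. x $ j) (UNIV - {k})" for x :: "real ^ 'm"
  proof -
    have comp: "off_axis (axis k 1) x $ j = (if j = k then 0 else x $ j)" for j
      by (simp add: off_axis_def inner_axis) (simp add: axis_def)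
    have "(\<Sum>j\<in>UNIV. (norm (off_axis (axis k 1) x $ j))\<^sup>2) = (\<Sum>j\<in>UNIV - {k}. (x $ j)\<^sup>2)"
      by (rule sum.mono_neutral_cong_right) (auto simp: comp)
    then show ?thesis
      by (simp add: norm_vec_def L2_set_def)
  qed
  then show ?thesis
    by (simp add: second_order_cone_def axis_cone_def inner_axis)
qed

theorem theorem4p1:
  fixes k :: "'m::finite" and x y :: "real ^ 'm"
  assumes "(x, y) \<in> soc_complementarity_set k"
  shows "regular_normal_cone (soc_complementarity_set k) (x, y)
       = proximal_normal_cone (soc_complementarity_set k) (x, y)"
proof -
  have eq: "soc_complementarity_set k = complementary_pairs (axis k 1)"
    by (simp add: soc_complementarity_set_def complementary_pairs_def second_order_cone_eq_axis_cone)
  have "quadratically_approximable (complementary_pairs (axis k 1)) (x, y)"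
    using assms unfolding eq by (intro quadratically_approximable_complementary_pairs) simp_all
  then show ?thesis
    unfolding eq by (rule regular_eq_proximal_if_quadratically_approximable)
qed

end
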